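(* Let $E$ be a finite set, $k\ge1$ an integer, and $(E,\mathcal{F})$ an accessible set system with $\mathcal{F}\neq\emptyset$ such that $\Gamma(X)\neq\emptyset$ for every $X\in\mathcal{F}$ with $|X|<k$. Then the following are equivalent: (1) $\mathcal{F}_k=\{X\in\mathcal{F}:|X|\le k\}$ is a $k$-truncated antimatroid, i.e. there is an antimatroid $(E,\mathcal{A})$ with $\mathcal{F}_k=\{X\in\mathcal{A}:|X|\le k\}$; (2) for every monotone linkage function $\pi$, every run of the Chain Algorithm with operator $\Gamma_{k-1}$ returns a set $X^0\in\mathcal{F}$ with $|X^0|\le k-1$ and $F_\Gamma(X^0)\ge F_\Gamma(Y)$ for all $Y\in\mathcal{F}$ with $|Y|\le k-1$.
   Context: Accessible: for each nonempty $X\in\mathcal{F}$ there is $x\in X$ with $X\setminus\{x\}\in\mathcal{F}$. Antimatroid: a nonempty accessible set system $(E,\mathcal{A})$ such that for all $X,Y\in\mathcal{A}$ with $X\not\subseteq Y$ there is $x\in X\setminus Y$ with $Y\cup\{x\}\in\mathcal{A}$. For $X\in\mathcal{F}$, $\Gamma(X)=\{x\in E\setminus X:X\cup\{x\}\in\mathcal{F}\}$, and $\Gamma_{k-1}(X)=\Gamma(X)$ if $|X|\le k-1$, $\Gamma_{k-1}(X)=\emptyset$ otherwise. A monotone linkage function is $\pi:E\times2^E\to\mathbb{R}$ with $\pi(x,X)\ge\pi(x,Y)$ whenever $X\subseteq Y$. $F_\Gamma(X)=\min_{x\in\Gamma(X)}\pi(x,X)$. Chain Algorithm with operator $\Gamma_{k-1}$: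 set $X^0=\emptyset$, $X=\emptyset$; while $\Gamma_{k-1}(X)\ne\emptyset$: if $F_\Gamma(X)>F_\Gamma(X^0)$ set $X^0=X$; choose any $x\in\Gamma(X)$ with $\pi(x,X)\le\pi(y,X)$ for all $y\in\Gamma(X)$; set $X=X\cup\{x\}$. Return $X^0$. *)

theory Defs
  imports Complex_Main
begin

definition set_system :: "'a set \<Rightarrow> 'a set set \<Rightarrow> bool" where
  "set_system E \<F> \<longleftrightarrow> \<F> \<subseteq> Pow E"

definition accessible :: "'a set set \<Rightarrow> bool" where
  "accessible \<F> \<longleftrightarrow> (\<forall>X\<in>\<F>. X \<noteq> {} \<longrightarrow> (\<exists>x\<in>X. X - {x} \<in> \<F>))"

definition antimatroid :: "'a set \<Rightarrow> 'a set set \<Rightarrow> bool" where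
  "antimatroid E \<A> \<longleftrightarrow>
     set_system E \<A> \<and> \<A> \<noteq> {} \<and> accessible \<A> \<and>
     (\<forall>X\<in>\<A>. \<forall>Y\<in>\<A>. \<not> X \<subseteq> Y \<longrightarrow> (\<exists>x\<in>X - Y. Y \<union> {x} \<in> \<A>))"

definition truncation :: "nat \<Rightarrow> 'a set set \<Rightarrow> 'a set set" where
  "truncation k \<F> = {X \<in> \<F>. card X \<le> k}"

definition truncated_antimatroid :: "nat \<Rightarrow> 'a set \<Rightarrow> 'a set set \<Rightarrow> bool" where
  "truncated_antimatroid k E \<G> \<longleftrightarrow> (\<exists>\<A>. antimatroid E \<A> \<and> \<G> = truncation k \<A>)"

definition Gam :: "'a set \<Rightarrow> 'a set set \<Rightarrow> 'a set \<Rightarrow> 'a set" where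
  "Gam E \<F> X = {x \<in> E - X. X \<union> {x} \<in> \<F>}"

definition Gam_trunc :: "nat \<Rightarrow> 'a set \<Rightarrow> 'a set set \<Rightarrow> 'a set \<Rightarrow> 'a set" where
  "Gam_trunc m E \<F> X = (if card X \<le> m then Gam E \<F> X else {})"

definition monotone_linkage :: "'a set \<Rightarrow> ('a \<Rightarrow> 'a set \<Rightarrow> real) \<Rightarrow> bool" where
  "monotone_linkage E \<pi> \<longleftrightarrow>
     (\<forall>x\<in>E. \<forall>X Y. X \<subseteq> Y \<and> Y \<subseteq> E \<longrightarrow> \<pi> x X \<ge> \<pi> x Y)"

text \<open>The minimum below is meaningful only if \<open>Gam E \<F> X\<close> is finite and nonempty; \<open>Min\<close> is
  unspecified otherwise.\<close>

definition F_Gam :: "'a set \<Rightarrow> 'a set set \<Rightarrow> ('a \<Rightarrow> 'a set \<Rightarrow> real) \<Rightarrow> 'a set \<Rightarrow> real" where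
  "F_Gam E \<F> \<pi> X = Min ((\<lambda>x. \<pi> x X) ` Gam E \<F> X)"

text \<open>A state of the Chain Algorithm is the pair \<open>(X0, X)\<close> of its two variables, and one step is
  one execution of the loop body, for an arbitrary admissible choice of \<open>x\<close>.\<close>

inductive chain_step ::
  "nat \<Rightarrow> 'a set \<Rightarrow> 'a set set \<Rightarrow> ('a \<Rightarrow> 'a set \<Rightarrow> real) \<Rightarrow>
   'a set \<times> 'a set \<Rightarrow> 'a set \<times> 'a set \<Rightarrow> bool"
  for m E \<F> \<pi> where
  "\<lbrakk>Gam_trunc m E \<F> X \<noteq> {};
    X0' = (if F_Gam E \<F> \<pi> X > F_Gam E \<F> \<pi> X0 then X else X0);
    x \<in> Gam E \<F> X; \<forall>y\<in>Gam E \<F> X. \<pi> x X \<le> \<pi> y X\<rbrakk>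
   \<Longrightarrow> chain_step m E \<F> \<pi> (X0, X) (X0', X \<union> {x})"

text \<open>Total correctness: there is no infinite run, and every run that cannot be continued has left
  the loop (rather than being stuck at the choice of \<open>x\<close>) and returns a set satisfying \<open>P\<close>.\<close>

definition every_chain_run_returns ::
  "nat \<Rightarrow> 'a set \<Rightarrow> 'a set set \<Rightarrow> ('a \<Rightarrow> 'a set \<Rightarrow> real) \<Rightarrow> ('a set \<Rightarrow> bool) \<Rightarrow> bool" where
  "every_chain_run_returns m E \<F> \<pi> P \<longleftrightarrow>
     \<not> (\<exists>s. s 0 = ({}, {}) \<and> (\<forall>i::nat. chain_step m E \<F> \<pi> (s i) (s (Suc i)))) \<and>
     (\<forall>X0 X. (chain_step m E \<F> \<pi>)\<^sup>*\<^sup>* ({}, {}) (X0, X) \<and>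
             \<not> (\<exists>t. chain_step m E \<F> \<pi> (X0, X) t)
             \<longrightarrow> Gam_trunc m E \<F> X = {} \<and> P X0)"

end

theory Submission imports Defs begin

text \<open>Both conditions are equivalent to the interval property: whenever \<open>X \<subseteq> Y\<close> are feasible,
  \<open>card Y < k\<close>, \<open>x \<notin> Y\<close> and \<open>X \<union> {x}\<close> is feasible, so is \<open>Y \<union> {x}\<close>.

  If the interval property holds, the unions of feasible sets of size at most \<open>k\<close> form an
  antimatroid whose \<open>k\<close>-truncation is the given one. Moreover, if \<open>Y\<close> is a competitor and \<open>x\<close> is
  the first element chosen by the algorithm outside \<open>Y\<close>, say at the set \<open>X \<subseteq> Y\<close>, then \<open>x\<close> is also
  available at \<open>Y\<close>, and monotonicity gives \<open>F(Y) \<le> \<pi>(x, Y) \<le> \<pi>(x, X) = F(X)\<close>.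

  If the interval property fails at \<open>X\<close>, \<open>Y\<close>, \<open>x\<close>, let \<open>\<pi>(z, Z) = 0\<close> if \<open>z \<in> X \<union> {x}\<close> or
  \<open>Z\<close> is not contained in \<open>Y\<close>, and \<open>\<pi>(z, Z) = 1\<close> otherwise. Some run builds \<open>X\<close>, then adds \<open>x\<close>, and
  sees only the value \<open>0\<close>, whereas \<open>F(Y) = 1\<close>.\<close>

definition interval_property :: "nat \<Rightarrow> 'a set set \<Rightarrow> bool" where
  "interval_property k \<F> \<longleftrightarrow>
     (\<forall>X\<in>\<F>. \<forall>Y\<in>\<F>. \<forall>x. X \<subseteq> Y \<and> card Y < k \<and> x \<notin> Y \<and> insert x X \<in> \<F> \<longrightarrow> insert x Y \<in> \<F>)"

lemma interval_propertyD:
  assumes "interval_property k \<F>" "X \<in> \<F>" "Y \<in> \<F>" "X \<subseteq> Y" "card Y < k" "x \<notin> Y" "insert x X \<in> \<F>"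
  shows "insert x Y \<in> \<F>"
  using assms unfolding interval_property_def by blast

section \<open>Feasible sets of an accessible set system\<close>

lemma finite_member:
  assumes "finite E" "set_system E \<F>" "X \<in> \<F>"
  shows "finite X"
  using assms finite_subset unfolding set_system_def by blast

lemma accessible_empty:
  assumes "accessible \<F>" "X \<in> \<F>" "finite X"
  shows "{} \<in> \<F>"
  using assms(3,2)
proof (induction X rule: finite_psubset_induct)
  case (psubset X)
  show ?case
  proof (cases "X = {}")
    case False
    then obtain x where "x \<in> X" "X - {x} \<in> \<F>"
      using assms(1) psubset.prems unfolding accessible_def by blast
    then show ?thesis
      using psubset.IH[of "X - {x}"] by blast
  qed (use psubset.prems in simp)
qed

text \<open>Accessibility allows \<open>X\<close> to be dismantled one element at a time down to the
  empty set. The element whose removal first leaves a subset of \<open>W\<close> is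
  \<open>x\<close>, and that subset is \<open>V\<close>.\<close>

lemma accessible_first_outside:
  assumes "accessible \<F>" "X \<in> \<F>" "finite X" "\<not> X \<subseteq> W"
  obtains V x where "V \<in> \<F>" "insert x V \<in> \<F>" "insert x V \<subseteq> X" "V \<subseteq> W" "x \<notin> W"
proof -
  have "\<exists>V x. V \<in> \<F> \<and> insert x V \<in> \<F> \<and> insert x V \<subseteq> X \<and> V \<subseteq> W \<and> x \<notin> W"
    using assms(3,2,4)
  proof (induction X rule: finite_psubset_induct)
    case (psubset X)
    then obtain x where x: "x \<in> X" "X - {x} \<in> \<F>"
      using assms(1) unfolding accessible_def by blast
    show ?case
    proof (cases "X - {x} \<subseteq> W")
      case True
      then have "x \<notin> W"
        using psubset.prems by blast
      moreover have "insert x (X - {x}) = X"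
        using x by blast
      ultimately show ?thesis
        using True x psubset.prems by (intro exI[of _ "X - {x}"] exI[of _ x]) simp
    next
      case False
      then obtain V y where "V \<in> \<F>" "insert y V \<in> \<F>" "insert y V \<subseteq> X - {x}" "V \<subseteq> W" "y \<notin> W"
        using psubset.IH[of "X - {x}"] x by blast
      then show ?thesis
        by blast
    qed
  qed
  then show thesis
    using that by blast
qed

lemma accessible_truncation:
  assumes "accessible \<F>"
  shows "accessible (truncation k \<F>)"
  unfolding accessible_def
proof (intro ballI impI)
  fix X assume X: "X \<in> truncation k \<F>" "X \<noteq> {}"
  then obtain x where "x \<in> X" "X - {x} \<in> \<F>"
    using assms unfolding accessible_def truncation_def by blast
  then show "\<exists>x\<in>X. X - {x} \<in> truncation k \<F>"
    using X(1) card_Diff1_le[of X x] unfolding truncation_def by force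
qed

subsection \<open>Truncated antimatroids\<close>

text \<open>The unions of arbitrary subfamilies of \<open>\<G>\<close>, the empty one included. The
  pointwise form avoids naming the subfamily.\<close>

definition union_closure :: "'a set set \<Rightarrow> 'a set set" where
  "union_closure \<G> = {Z. \<forall>z\<in>Z. \<exists>X\<in>\<G>. z \<in> X \<and> X \<subseteq> Z}"

lemma union_closureI: "Z \<in> \<G> \<Longrightarrow> Z \<in> union_closure \<G>"
  unfolding union_closure_def by blast

lemma union_closure_Un:
  "Y \<in> union_closure \<G> \<Longrightarrow> Z \<in> union_closure \<G> \<Longrightarrow> Y \<union> Z \<in> union_closure \<G>"
  unfolding union_closure_def by (blast intro: le_supI1 le_supI2)

text \<open>Some member \<open>U\<close> of \<open>\<G>\<close> inside \<open>X\<close> is not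
  contained in \<open>Y\<close>. Building \<open>U\<close> up from within \<open>Y\<close>, the
  first element \<open>x\<close> outside \<open>Y\<close> completes a member of \<open>\<G>\<close>
  whose union with \<open>Y\<close> is just \<open>insert x Y\<close>.\<close>

lemma union_closure_augment:
  assumes "accessible \<G>" "\<And>X. X \<in> \<G> \<Longrightarrow> finite X"
    and "X \<in> union_closure \<G>" "Y \<in> union_closure \<G>" "\<not> X \<subseteq> Y"
  obtains x where "x \<in> X - Y" "insert x Y \<in> union_closure \<G>"
proof -
  obtain z where "z \<in> X" "z \<notin> Y"
    using assms(5) by blast
  then obtain U where U: "U \<in> \<G>" "z \<in> U" "U \<subseteq> X"
    using assms(3) unfolding union_closure_def by blast
  then have "\<not> U \<subseteq> Y"
    using \<open>z \<notin> Y\<close> by blast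
  then obtain V x where V: "insert x V \<in> \<G>" "insert x V \<subseteq> U" "V \<subseteq> Y" "x \<notin> Y"
    using accessible_first_outside[OF assms(1) U(1) assms(2)[OF U(1)]] by metis
  have "Y \<union> insert x V = insert x Y"
    using V by blast
  then have "insert x Y \<in> union_closure \<G>"
    using union_closure_Un[OF assms(4) union_closureI[OF V(1)]] by simp
  then show thesis
    using that V U by blast
qed

lemma antimatroid_union_closure:
  assumes "finite E" "set_system E \<G>" "accessible \<G>"
  shows "antimatroid E (union_closure \<G>)"
proof -
  have fin: "finite X" if "X \<in> \<G>" for X
    using finite_member[OF assms(1,2) that] .
  have sub: "Z \<subseteq> E" if "Z \<in> union_closure \<G>" for Z
    using that assms(2) unfolding union_closure_def set_system_def by blast
  have empty: "{} \<in> union_closure \<G>"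
    unfolding union_closure_def by blast
  have "\<exists>x\<in>Z. Z - {x} \<in> union_closure \<G>" if Z: "Z \<in> union_closure \<G>" "Z \<noteq> {}" for Z
  proof -
    \<comment> \<open>Augmenting a maximal proper submember \<open>W\<close> towards
      \<open>Z\<close> adds a single element, which by maximality already gives
      \<open>Z\<close>.\<close>
    let ?B = "{W \<in> union_closure \<G>. W \<subset> Z}"
    have "finite ?B"
      using finite_subset[OF sub[OF Z(1)] assms(1)] by (rule_tac finite_subset[of _ "Pow Z"]) auto
    moreover have "?B \<noteq> {}"
      using empty Z by blast
    ultimately obtain W where W: "W \<in> ?B" and max: "\<And>V. V \<in> ?B \<Longrightarrow> W \<subseteq> V \<Longrightarrow> V = W"
      using finite_has_maximal[of ?B] by metis
    then obtain x where x: "x \<in> Z - W" "insert x W \<in> union_closure \<G>"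
      using union_closure_augment[OF assms(3) fin Z(1), of W] by blast
    then have "insert x W = Z"
      using max[of "insert x W"] W by blast
    then have "Z - {x} = W"
      using x by blast
    then show ?thesis
      using x W by blast
  qed
  moreover have "\<exists>x\<in>X - Y. Y \<union> {x} \<in> union_closure \<G>"
    if "X \<in> union_closure \<G>" "Y \<in> union_closure \<G>" "\<not> X \<subseteq> Y" for X Y
    using union_closure_augment[OF assms(3) fin that] by (metis Un_insert_right sup_bot_right)
  ultimately show ?thesis
    using sub empty unfolding antimatroid_def set_system_def accessible_def by blast
qed

text \<open>For a union \<open>Z\<close> of size at most \<open>k\<close>, a maximal feasible subset
  \<open>Y\<close> must be \<open>Z\<close> itself: otherwise \<open>card Y < k\<close>, and the
  interval property adds to \<open>Y\<close> the first element outside it of some feasible subset of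
  \<open>Z\<close>.\<close>

lemma truncation_union_closure:
  assumes "finite E" "set_system E \<F>" "accessible \<F>" "\<F> \<noteq> {}" "interval_property k \<F>"
  shows "truncation k (union_closure (truncation k \<F>)) = truncation k \<F>"
proof
  show "truncation k \<F> \<subseteq> truncation k (union_closure (truncation k \<F>))"
    using union_closureI[of _ "truncation k \<F>"] by (auto simp: truncation_def)
  show "truncation k (union_closure (truncation k \<F>)) \<subseteq> truncation k \<F>"
  proof
    fix Z assume "Z \<in> truncation k (union_closure (truncation k \<F>))"
    then have Z: "\<And>z. z \<in> Z \<Longrightarrow> \<exists>X\<in>\<F>. card X \<le> k \<and> z \<in> X \<and> X \<subseteq> Z" "card Z \<le> k"
      unfolding truncation_def union_closure_def by blast+
    have "Z \<subseteq> E"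
      using Z(1) assms(2) unfolding set_system_def by blast
    then have finZ: "finite Z"
      using assms(1) finite_subset by blast
    let ?B = "{Y \<in> \<F>. Y \<subseteq> Z}"
    have "finite ?B"
      using finZ by (rule_tac finite_subset[of _ "Pow Z"]) auto
    moreover have "{} \<in> \<F>"
      using accessible_empty[OF assms(3)] finite_member[OF assms(1,2)] assms(4) by blast
    ultimately obtain Y where Y: "Y \<in> ?B" and max: "\<And>V. V \<in> ?B \<Longrightarrow> Y \<subseteq> V \<Longrightarrow> V = Y"
      using finite_has_maximal[of ?B] by (metis (no_types, lifting) empty_iff empty_subsetI mem_Collect_eq)
    have "Y = Z"
    proof (rule ccontr)
      assume "Y \<noteq> Z"
      then have "Y \<subset> Z"
        using Y by blast
      then have less: "card Y < k"
        using psubset_card_mono[OF finZ \<open>Y \<subset> Z\<close>] Z(2) by linarith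
      obtain X where X: "X \<in> \<F>" "X \<subseteq> Z" "\<not> X \<subseteq> Y"
        using Z(1) \<open>Y \<subset> Z\<close> by blast
      then obtain V x where V: "V \<in> \<F>" "insert x V \<in> \<F>" "insert x V \<subseteq> X" "V \<subseteq> Y" "x \<notin> Y"
        using accessible_first_outside[OF assms(3) X(1) finite_member[OF assms(1,2) X(1)]] by metis
      then have "insert x Y \<in> \<F>"
        using interval_propertyD[OF assms(5) V(1) _ V(4) less V(5,2)] Y by blast
      then show False
        using max[of "insert x Y"] V X Y by blast
    qed
    then show "Z \<in> truncation k \<F>"
      using Y Z(2) unfolding truncation_def by blast
  qed
qed

lemma truncated_antimatroid_iff_interval_property:
  assumes "finite E" "set_system E \<F>" "accessible \<F>" "\<F> \<noteq> {}"
  shows "truncated_antimatroid k E (truncation k \<F>) \<longleftrightarrow> interval_property k \<F>"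
proof
  assume "truncated_antimatroid k E (truncation k \<F>)"
  then obtain \<A> where \<A>: "antimatroid E \<A>" and eq: "truncation k \<F> = truncation k \<A>"
    unfolding truncated_antimatroid_def by blast
  have mem: "Z \<in> \<A> \<longleftrightarrow> Z \<in> \<F>" if "card Z \<le> k" for Z
    using eq that unfolding truncation_def by blast
  show "interval_property k \<F>"
    unfolding interval_property_def
  proof (intro ballI allI impI, elim conjE)
    fix X Y x
    assume *: "X \<in> \<F>" "Y \<in> \<F>" "X \<subseteq> Y" "card Y < k" "x \<notin> Y" "insert x X \<in> \<F>"
    have fin: "finite Y"
      using finite_member assms * by blast
    \<comment> \<open>\<open>\<A>\<close> and \<open>\<F>\<close> are known to agree only up to size
      \<open>k\<close>, so both enlarged sets have to be bounded. The exchange axiom can then only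
      add \<open>x\<close>, since \<open>X \<subseteq> Y\<close>.\<close>
    have cY: "card (insert x Y) \<le> k"
      using * fin by simp
    moreover have "card (insert x X) \<le> card (insert x Y)"
      using * fin by (intro card_mono) auto
    ultimately have "insert x X \<in> \<A>" "Y \<in> \<A>"
      using * mem by auto
    moreover have "\<not> insert x X \<subseteq> Y"
      using * by blast
    ultimately have "\<exists>y\<in>insert x X - Y. Y \<union> {y} \<in> \<A>"
      using \<A> unfolding antimatroid_def by simp
    then obtain y where "y \<in> insert x X - Y" "Y \<union> {y} \<in> \<A>"
      by (elim bexE)
    moreover from this have "y = x"
      using * by blast
    ultimately show "insert x Y \<in> \<F>"
      using mem[OF cY] by simp
  qed
next
  assume "interval_property k \<F>"
  moreover have "set_system E (truncation k \<F>)"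
    using assms(2) unfolding set_system_def truncation_def by blast
  ultimately show "truncated_antimatroid k E (truncation k \<F>)"
    using truncation_union_closure[OF assms] antimatroid_union_closure[OF assms(1)]
      accessible_truncation[OF assms(3)]
    unfolding truncated_antimatroid_def by metis
qed

subsection \<open>The Chain Algorithm\<close>

lemma Gam_iff: "x \<in> Gam E \<F> X \<longleftrightarrow> x \<in> E \<and> x \<notin> X \<and> insert x X \<in> \<F>"
  unfolding Gam_def by simp

lemma finite_Gam: "finite E \<Longrightarrow> finite (Gam E \<F> X)"
  unfolding Gam_def by simp

lemma F_Gam_le:
  assumes "finite E" "x \<in> Gam E \<F> X"
  shows "F_Gam E \<F> \<pi> X \<le> \<pi> x X"
  using assms unfolding F_Gam_def by (intro Min_le) (auto simp: finite_Gam)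

lemma F_Gam_eq:
  assumes "finite E" "x \<in> Gam E \<F> X" "\<forall>y\<in>Gam E \<F> X. \<pi> x X \<le> \<pi> y X"
  shows "F_Gam E \<F> \<pi> X = \<pi> x X"
  using assms unfolding F_Gam_def by (intro Min_eqI) (auto simp: finite_Gam)

lemma Gam_minimizer:
  fixes \<pi> :: "'a \<Rightarrow> 'a set \<Rightarrow> real"
  assumes "finite E" "Gam E \<F> X \<noteq> {}"
  obtains x where "x \<in> Gam E \<F> X" "\<forall>y\<in>Gam E \<F> X. \<pi> x X \<le> \<pi> y X"
proof -
  have "Min ((\<lambda>x. \<pi> x X) ` Gam E \<F> X) \<in> (\<lambda>x. \<pi> x X) ` Gam E \<F> X"
    using assms by (intro Min_in) (auto simp: finite_Gam)
  then obtain x where "x \<in> Gam E \<F> X" "\<pi> x X = Min ((\<lambda>x. \<pi> x X) ` Gam E \<F> X)"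
    by auto
  then show thesis
    using that[of x] assms(1) by (simp add: finite_Gam)
qed

text \<open>Finiteness of \<open>E\<close> provides a minimizer, so a run can stop only by leaving
  the loop.\<close>

lemma chain_step_exists:
  assumes "finite E" "Gam_trunc m E \<F> X \<noteq> {}"
  shows "\<exists>t. chain_step m E \<F> \<pi> (X0, X) t"
proof -
  have "Gam E \<F> X \<noteq> {}"
    using assms(2) unfolding Gam_trunc_def by (auto split: if_splits)
  then obtain x where "x \<in> Gam E \<F> X" "\<forall>y\<in>Gam E \<F> X. \<pi> x X \<le> \<pi> y X"
    using Gam_minimizer[OF assms(1)] by metis
  then show ?thesis
    using chain_step.intros[OF assms(2) refl] by blast
qed

text \<open>After \<open>i\<close> steps the current set has exactly \<open>i\<close> elements of
  \<open>E\<close>, which is impossible for \<open>i > card E\<close>.\<close>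

lemma no_infinite_chain_run:
  assumes "finite E" "s 0 = ({}, {})" "\<forall>i::nat. chain_step m E \<F> \<pi> (s i) (s (Suc i))"
  shows False
proof -
  have "snd (s i) \<subseteq> E \<and> card (snd (s i)) = i" for i
  proof (induction i)
    case (Suc i)
    have "chain_step m E \<F> \<pi> (s i) (s (Suc i))"
      using assms(3) by blast
    then obtain x where "x \<in> Gam E \<F> (snd (s i))" "snd (s (Suc i)) = insert x (snd (s i))"
      by cases auto
    moreover have "finite (snd (s i))"
      using Suc finite_subset[OF _ assms(1)] by blast
    ultimately show ?case
      using Suc by (simp add: Gam_iff)
  qed (simp add: assms(2))
  from this[of "Suc (card E)"] show False
    using card_mono[OF assms(1), of "snd (s (Suc (card E)))"] by linarith
qed

section \<open>The interval property makes every run optimal\<close>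

text \<open>The competitors already beaten are those not containing the current set; initially there
  are none. A step newly includes those \<open>Y\<close> that contain \<open>X\<close> but not the
  chosen \<open>x\<close>, and the value at \<open>X0\<close> never decreases.\<close>

lemma chain_run_invariant:
  assumes "finite E" "k \<ge> 1" "set_system E \<F>" "{} \<in> \<F>"
    and int: "interval_property k \<F>" and mono: "monotone_linkage E \<pi>"
    and run: "(chain_step (k - 1) E \<F> \<pi>)\<^sup>*\<^sup>* ({}, {}) (X0, X)"
  shows "X \<in> \<F> \<and> X0 \<in> \<F> \<and> card X0 \<le> k - 1 \<and>
    (\<forall>Y\<in>\<F>. card Y \<le> k - 1 \<longrightarrow> \<not> X \<subseteq> Y \<longrightarrow> F_Gam E \<F> \<pi> Y \<le> F_Gam E \<F> \<pi> X0)"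
  using run
proof (induction rule: rtranclp_induct2)
  case refl
  then show ?case
    using assms(4) by simp
next
  case (step X0 X X0' X')
  from step.hyps(2) obtain x where
    trunc: "Gam_trunc (k - 1) E \<F> X \<noteq> {}"
    and X0': "X0' = (if F_Gam E \<F> \<pi> X > F_Gam E \<F> \<pi> X0 then X else X0)"
    and X': "X' = insert x X"
    and x: "x \<in> Gam E \<F> X" "\<forall>y\<in>Gam E \<F> X. \<pi> x X \<le> \<pi> y X"
    by cases auto
  have "card X \<le> k - 1"
    using trunc unfolding Gam_trunc_def by (auto split: if_splits)
  moreover have "F_Gam E \<F> \<pi> Y \<le> F_Gam E \<F> \<pi> X0'"
    if Y: "Y \<in> \<F>" "card Y \<le> k - 1" "\<not> X' \<subseteq> Y" for Y
  proof (cases "X \<subseteq> Y")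
    case True
    then have "x \<notin> Y"
      using Y X' by blast
    then have "insert x Y \<in> \<F>"
      using interval_propertyD[OF int _ Y(1) True] step.IH x(1) Y(2) \<open>k \<ge> 1\<close>
      by (auto simp: Gam_iff)
    then have "F_Gam E \<F> \<pi> Y \<le> \<pi> x Y"
      using F_Gam_le[OF assms(1)] x(1) \<open>x \<notin> Y\<close> by (simp add: Gam_iff)
    also have "\<dots> \<le> \<pi> x X"
      using mono True x(1) Y(1) assms(3) unfolding monotone_linkage_def set_system_def
      by (auto simp: Gam_iff)
    also have "\<dots> = F_Gam E \<F> \<pi> X"
      using F_Gam_eq[where \<pi> = \<pi>, OF assms(1) x] by simp
    also have "\<dots> \<le> F_Gam E \<F> \<pi> X0'"
      using X0' by simp
    finally show ?thesis .
  next
    case False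
    then have "F_Gam E \<F> \<pi> Y \<le> F_Gam E \<F> \<pi> X0"
      using step.IH Y by blast
    also have "\<dots> \<le> F_Gam E \<F> \<pi> X0'"
      using X0' by simp
    finally show ?thesis .
  qed
  ultimately show ?case
    using step.IH x(1) X0' X' by (simp add: Gam_iff)
qed

lemma interval_property_chain_run_optimal:
  assumes "finite E" "k \<ge> 1" "set_system E \<F>" "{} \<in> \<F>"
    and ne: "\<forall>X\<in>\<F>. card X < k \<longrightarrow> Gam E \<F> X \<noteq> {}"
    and "interval_property k \<F>" "monotone_linkage E \<pi>"
  shows "every_chain_run_returns (k - 1) E \<F> \<pi>
    (\<lambda>X0. X0 \<in> \<F> \<and> card X0 \<le> k - 1 \<and>
      (\<forall>Y\<in>\<F>. card Y \<le> k - 1 \<longrightarrow> F_Gam E \<F> \<pi> X0 \<ge> F_Gam E \<F> \<pi> Y))"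
  unfolding every_chain_run_returns_def
proof (intro conjI allI impI)
  show "\<not> (\<exists>s. s 0 = ({}, {}) \<and> (\<forall>i. chain_step (k - 1) E \<F> \<pi> (s i) (s (Suc i))))"
    using no_infinite_chain_run[OF assms(1)] by metis
next
  fix X0 X
  assume *: "(chain_step (k - 1) E \<F> \<pi>)\<^sup>*\<^sup>* ({}, {}) (X0, X) \<and>
    \<not> (\<exists>t. chain_step (k - 1) E \<F> \<pi> (X0, X) t)"
  then show empty: "Gam_trunc (k - 1) E \<F> X = {}"
    using chain_step_exists[OF assms(1)] by blast
  have inv: "X \<in> \<F> \<and> X0 \<in> \<F> \<and> card X0 \<le> k - 1 \<and>
    (\<forall>Y\<in>\<F>. card Y \<le> k - 1 \<longrightarrow> \<not> X \<subseteq> Y \<longrightarrow> F_Gam E \<F> \<pi> Y \<le> F_Gam E \<F> \<pi> X0)"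
    using chain_run_invariant assms * by blast
  \<comment> \<open>A feasible set smaller than \<open>k\<close> would have a continuation. Hence
    the final set is too large to lie in any competitor, and the invariant covers all of
    them.\<close>
  then have "card X \<ge> k"
    using ne empty \<open>k \<ge> 1\<close> unfolding Gam_trunc_def by (force split: if_splits)
  then have "\<not> X \<subseteq> Y" if "Y \<in> \<F>" "card Y \<le> k - 1" for Y
    using card_mono[OF finite_member[OF assms(1,3) that(1)], of X] that(2) \<open>k \<ge> 1\<close> by fastforce
  then show "X0 \<in> \<F>" "card X0 \<le> k - 1"
    "\<forall>Y\<in>\<F>. card Y \<le> k - 1 \<longrightarrow> F_Gam E \<F> \<pi> Y \<le> F_Gam E \<F> \<pi> X0"
    using inv by blast+
qed

section \<open>A failure of the interval property yields a bad run\<close>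

lemma chain_run_optimal_imp_interval_property:
  assumes "finite E" "set_system E \<F>" "accessible \<F>"
    and ne: "\<forall>X\<in>\<F>. card X < k \<longrightarrow> Gam E \<F> X \<noteq> {}"
    and opt: "\<And>\<pi>. monotone_linkage E \<pi> \<Longrightarrow> every_chain_run_returns (k - 1) E \<F> \<pi>
      (\<lambda>X0. \<forall>Y\<in>\<F>. card Y \<le> k - 1 \<longrightarrow> F_Gam E \<F> \<pi> X0 \<ge> F_Gam E \<F> \<pi> Y)"
  shows "interval_property k \<F>"
  unfolding interval_property_def
proof (intro ballI allI impI, elim conjE, rule ccontr)
  fix X Y x
  assume X: "X \<in> \<F>" and Y: "Y \<in> \<F>" and XY: "X \<subseteq> Y" and cY: "card Y < k" and xY: "x \<notin> Y"
    and xX: "insert x X \<in> \<F>" and not: "insert x Y \<notin> \<F>"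
  \<comment> \<open>Monotone because, for fixed \<open>z\<close>, the value can only drop from 1 to
    0 when \<open>Z\<close> grows beyond \<open>Y\<close>.\<close>
  define \<pi> :: "'a \<Rightarrow> 'a set \<Rightarrow> real" where
    "\<pi> = (\<lambda>z Z. if z \<in> insert x X \<or> \<not> Z \<subseteq> Y then 0 else 1)"
  let ?step = "chain_step (k - 1) E \<F> \<pi>"
  have mono: "monotone_linkage E \<pi>"
    unfolding monotone_linkage_def \<pi>_def by auto
  have nonneg: "\<pi> z Z \<ge> 0" for z Z
    unfolding \<pi>_def by simp
  have finY: "finite Y"
    using finite_member assms(1,2) Y by blast
  have finX: "finite X"
    using finY XY finite_subset by blast
  have cX: "card X < k"
    using card_mono[OF finY XY] cY by simp
  have xE: "insert x X \<subseteq> E"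
    using xX assms(2) unfolding set_system_def by blast

  have F0: "F_Gam E \<F> \<pi> Z = 0" if "z \<in> Gam E \<F> Z" "\<pi> z Z = 0" for z Z
    using F_Gam_eq[OF assms(1) that(1), of \<pi>] that(2) nonneg by simp

  have F_empty: "F_Gam E \<F> \<pi> {} = 0"
  proof -
    have "\<not> insert x X \<subseteq> {}"
      by simp
    \<comment> \<open>With the empty set as the set to leave, \<open>V\<close> is empty and
      \<open>z\<close> is a feasible singleton's element in \<open>insert x X\<close>, hence of
      weight 0.\<close>
    then obtain V z where "insert z V \<in> \<F>" "insert z V \<subseteq> insert x X" "V \<subseteq> {}"
      using accessible_first_outside[OF assms(3) xX] finX by (metis finite_insert)
    then show ?thesis
      using xE by (intro F0[of z]) (auto simp: Gam_iff \<pi>_def)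
  qed

  \<comment> \<open>An element of weight 0 is always an admissible choice. The update test is
    strict, so the value 0 never replaces the initial \<open>{}\<close>.\<close>
  have step_add: "?step ({}, Z) ({}, insert z Z)"
    if "card Z < k" "z \<in> Gam E \<F> Z" "\<pi> z Z = 0" for z Z
  proof -
    have "?step ({}, Z) ({}, Z \<union> {z})"
      using that F0[OF that(2,3)] F_empty nonneg
      by (intro chain_step.intros) (auto simp: Gam_trunc_def)
    then show ?thesis
      by simp
  qed

  \<comment> \<open>Accessibility supplies an order of construction, and every element of
    \<open>X\<close> has weight 0.\<close>
  have reach: "?step\<^sup>*\<^sup>* ({}, {}) ({}, Z)" if "Z \<in> \<F>" "Z \<subseteq> X" for Z
    using finite_subset[OF that(2) finX] that
  proof (induction Z rule: finite_psubset_induct)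
    case (psubset Z)
    show ?case
    proof (cases "Z = {}")
      case False
      then obtain z where z: "z \<in> Z" "Z - {z} \<in> \<F>"
        using assms(3) psubset.prems unfolding accessible_def by blast
      have "card (Z - {z}) < k"
        using card_mono[OF finX, of "Z - {z}"] psubset.prems cX by fastforce
      moreover have "insert z (Z - {z}) = Z"
        using z by blast
      moreover have "z \<in> Gam E \<F> (Z - {z})" "\<pi> z (Z - {z}) = 0"
        using z psubset.prems xE \<open>insert z (Z - {z}) = Z\<close> by (auto simp: Gam_iff \<pi>_def)
      ultimately have "?step ({}, Z - {z}) ({}, Z)"
        using step_add[of "Z - {z}" z] by simp
      moreover have "?step\<^sup>*\<^sup>* ({}, {}) ({}, Z - {z})"
        using psubset.IH[of "Z - {z}"] psubset.prems z by blast
      ultimately show ?thesis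
        by (rule_tac rtranclp.rtrancl_into_rtrancl)
    qed simp
  qed

  \<comment> \<open>Once \<open>x\<close> is included the current set is no longer inside
    \<open>Y\<close>, so all weights are 0 and every choice is harmless. A maximal set in
    \<open>?R\<close> is therefore the end of a run that still returns \<open>{}\<close>.\<close>
  let ?R = "{Z. x \<in> Z \<and> Z \<in> \<F> \<and> ?step\<^sup>*\<^sup>* ({}, {}) ({}, Z)}"
  have "?step ({}, X) ({}, insert x X)"
    using xY XY xX xE cX by (intro step_add) (auto simp: Gam_iff \<pi>_def)
  then have "insert x X \<in> ?R"
    using reach[OF X subset_refl] xX by (auto intro: rtranclp.rtrancl_into_rtrancl)
  moreover have "finite ?R"
    using assms(1,2) unfolding set_system_def by (rule_tac finite_subset[of _ "Pow E"]) auto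
  ultimately obtain Z where Z: "Z \<in> ?R" and max: "\<And>V. V \<in> ?R \<Longrightarrow> Z \<subseteq> V \<Longrightarrow> V = Z"
    using finite_has_maximal[of ?R] by (metis (no_types, lifting) empty_iff)
  have "Gam_trunc (k - 1) E \<F> Z = {}"
  proof (rule ccontr)
    assume "Gam_trunc (k - 1) E \<F> Z \<noteq> {}"
    then obtain z where z: "z \<in> Gam E \<F> Z" and "card Z \<le> k - 1"
      unfolding Gam_trunc_def by (auto split: if_splits)
    moreover have "\<pi> z Z = 0"
      using Z xY by (auto simp: \<pi>_def)
    ultimately have "?step ({}, Z) ({}, insert z Z)"
      \<comment> \<open>\<open>cY\<close> forces \<open>k > 0\<close>, which turns
        \<open>card Z \<le> k - 1\<close> into \<open>card Z < k\<close>.\<close>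
      using cY by (intro step_add) auto
    then have "insert z Z \<in> ?R"
      using Z z by (auto simp: Gam_iff intro: rtranclp.rtrancl_into_rtrancl)
    then show False
      using max z by (auto simp: Gam_iff)
  qed
  then have "\<not> (\<exists>t. ?step ({}, Z) t)"
    by (auto elim: chain_step.cases)
  then have "F_Gam E \<F> \<pi> Y \<le> F_Gam E \<F> \<pi> {}"
    using opt[OF mono] Z Y cY unfolding every_chain_run_returns_def by auto
  moreover have "F_Gam E \<F> \<pi> Y = 1"
  proof -
    \<comment> \<open>An element available at \<open>Y\<close> is outside \<open>X\<close>, and it
      is not \<open>x\<close> because \<open>insert x Y\<close> is infeasible.\<close>
    have one: "\<pi> z Y = 1" if "z \<in> Gam E \<F> Y" for z
      using that not XY by (auto simp: Gam_iff \<pi>_def)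
    obtain z where "z \<in> Gam E \<F> Y"
      using ne Y cY by blast
    then show ?thesis
      using F_Gam_eq[OF assms(1), of z \<F> Y \<pi>] one by simp
  qed
  ultimately show False
    using F_empty by simp
qed

theorem theorem5:
  fixes E :: "'a set" and \<F> :: "'a set set" and k :: nat
  assumes "finite E" and "k \<ge> 1"
    and "set_system E \<F>" and "accessible \<F>" and "\<F> \<noteq> {}"
    and "\<forall>X\<in>\<F>. card X < k \<longrightarrow> Gam E \<F> X \<noteq> {}"
  shows "truncated_antimatroid k E (truncation k \<F>) \<longleftrightarrow>
    (\<forall>\<pi>. monotone_linkage E \<pi> \<longrightarrow>
      every_chain_run_returns (k - 1) E \<F> \<pi>
        (\<lambda>X0. X0 \<in> \<F> \<and> card X0 \<le> k - 1 \<and>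
          (\<forall>Y\<in>\<F>. card Y \<le> k - 1 \<longrightarrow> F_Gam E \<F> \<pi> X0 \<ge> F_Gam E \<F> \<pi> Y)))"
    (is "?L \<longleftrightarrow> (\<forall>\<pi>. monotone_linkage E \<pi> \<longrightarrow> ?opt \<pi>)")
proof -
  have "{} \<in> \<F>"
    using accessible_empty[OF assms(4)] finite_member[OF assms(1,3)] assms(5) by blast
  then have "interval_property k \<F> \<Longrightarrow> monotone_linkage E \<pi> \<Longrightarrow> ?opt \<pi>" for \<pi>
    using interval_property_chain_run_optimal[OF assms(1-3) _ assms(6)] by blast
  moreover have "interval_property k \<F>" if "\<forall>\<pi>. monotone_linkage E \<pi> \<longrightarrow> ?opt \<pi>"
  proof (rule chain_run_optimal_imp_interval_property[OF assms(1,3,4,6)])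
    fix \<pi> assume "monotone_linkage E \<pi>"
    then have "?opt \<pi>"
      using that by blast
    then show "every_chain_run_returns (k - 1) E \<F> \<pi>
      (\<lambda>X0. \<forall>Y\<in>\<F>. card Y \<le> k - 1 \<longrightarrow> F_Gam E \<F> \<pi> X0 \<ge> F_Gam E \<F> \<pi> Y)"
      unfolding every_chain_run_returns_def by blast
  qed
  ultimately show ?thesis
    unfolding truncated_antimatroid_iff_interval_property[OF assms(1,3-5)] by blast
qed

end
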